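(* Let $n\ge1$ be an integer, $\theta\in\mathbb{R}$, $0<\sigma_1\le\sigma_2\le\cdots\le\sigma_n$, and let $\delta\in\bigl(\exp(-(\sqrt2-1)^2 n),\,\tfrac14\bigr)$. Let $X_1,\dots,X_n$ be independent Gaussian random variables with $X_i\sim\mathcal{N}(\theta,\sigma_i^2)$. Then, with probability at least $\delta$, $$\bigl|\widehat{\mathrm{med}}(X_1,\dots,X_n)-\theta\bigr|\ \ge\ 0.13\,\frac{\sqrt{n\log(1/\delta)}}{\sum_{i=j+1}^{n}\sigma_i^{-1}},\qquad\text{where } j=\left\lfloor 0.05\sqrt{n\log(1/\delta)}\right\rfloor.$$
   Context: $\widehat{\mathrm{med}}(X_1,\dots,X_n)$ denotes the empirical median, with the convention that for every real $t$, $\widehat{\mathrm{med}}(X_1,\dots,X_n)\ge t$ if and only if $\#\{i: X_i\ge t\}\ge n/2$ (i.e. it is the order statistic of rank $\lfloor n/2\rfloor+1$ in increasing order). $\log$ is the natural logarithm and $\lfloor\cdot\rfloor$ the floor function. *)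

theory Defs
  imports "HOL-Probability.Probability"
begin

text \<open>The list is indexed from 0, so this is the order statistic of rank
  \<open>\<lfloor>n/2\<rfloor> + 1\<close> in increasing order; it is meaningful for \<open>n \<ge> 1\<close>.\<close>

definition emp_median :: "nat \<Rightarrow> (nat \<Rightarrow> real) \<Rightarrow> real" where
  "emp_median n x = sort (map x [1..<Suc n]) ! (n div 2)"

lemma sorted_nth_ge_iff:
  fixes xs :: "real list"
  assumes "sorted xs" "k < length xs"
  shows "t \<le> xs ! k \<longleftrightarrow> length xs - k \<le> card {i. i < length xs \<and> t \<le> xs ! i}"
proof
  assume t: "t \<le> xs ! k"
  have "{k..<length xs} \<subseteq> {i. i < length xs \<and> t \<le> xs ! i}"
    using assms t by (auto intro!: order_trans[OF t sorted_nth_mono])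
  then have "card {k..<length xs} \<le> card {i. i < length xs \<and> t \<le> xs ! i}"
    by (intro card_mono) auto
  then show "length xs - k \<le> card {i. i < length xs \<and> t \<le> xs ! i}"
    by simp
next
  assume c: "length xs - k \<le> card {i. i < length xs \<and> t \<le> xs ! i}"
  show "t \<le> xs ! k"
  proof (rule ccontr)
    assume nt: "\<not> t \<le> xs ! k"
    have "{i. i < length xs \<and> t \<le> xs ! i} \<subseteq> {Suc k..<length xs}"
    proof
      fix i assume i: "i \<in> {i. i < length xs \<and> t \<le> xs ! i}"
      have "\<not> i \<le> k"
        using i nt assms sorted_nth_mono[of xs i k] by fastforce
      then show "i \<in> {Suc k..<length xs}" using i by simp
    qed
    then have "card {i. i < length xs \<and> t \<le> xs ! i} \<le> card {Suc k..<length xs}"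
      by (intro card_mono) auto
    with c assms(2) show False by simp
  qed
qed

lemma emp_median_ge_iff:
  assumes "n \<ge> 1"
  shows "emp_median n x \<ge> t \<longleftrightarrow> real (card {i \<in> {1..n}. x i \<ge> t}) \<ge> real n / 2"
proof -
  define ys where "ys = map x [1..<Suc n]"
  have len: "length (sort ys) = n" by (simp add: ys_def)
  have "card {i. i < length (sort ys) \<and> t \<le> sort ys ! i} = length (filter (\<lambda>y. t \<le> y) (sort ys))"
    by (simp add: length_filter_conv_card)
  also have "\<dots> = length (filter (\<lambda>y. t \<le> y) ys)"
    by (metis mset_filter mset_sort size_mset)
  also have "\<dots> = length (filter (\<lambda>i. t \<le> x i) [1..<Suc n])"
    by (simp add: ys_def filter_map o_def del: upt_Suc)
  also have "\<dots> = card (set (filter (\<lambda>i. t \<le> x i) [1..<Suc n]))"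
    by (metis distinct_card distinct_filter distinct_upt)
  also have "set (filter (\<lambda>i. t \<le> x i) [1..<Suc n]) = {i \<in> {1..n}. x i \<ge> t}"
    by auto
  finally have card: "card {i. i < length (sort ys) \<and> t \<le> sort ys ! i}
      = card {i \<in> {1..n}. x i \<ge> t}" .
  have "emp_median n x \<ge> t \<longleftrightarrow> n - n div 2 \<le> card {i \<in> {1..n}. x i \<ge> t}"
    using sorted_nth_ge_iff[of "sort ys" "n div 2" t] assms len card
    by (simp add: emp_median_def ys_def del: upt_Suc)
  also have "\<dots> \<longleftrightarrow> n \<le> 2 * card {i \<in> {1..n}. x i \<ge> t}"
    by linarith
  also have "\<dots> \<longleftrightarrow> real (card {i \<in> {1..n}. x i \<ge> t}) \<ge> real n / 2"
    by linarith
  finally show ?thesis .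
qed

end

(* Only the event that the median is at least theta + t is used, where t is the claimed deviation.
   It says that at least half of the independent events X_i >= theta + t occur; each has probability
   at least 1/2 - q_i, where q_i = 1/2 for i <= j and q_i = 0.4 t / sigma_i otherwise, and the q_i
   add up to at most 0.077 S with S = sqrt (n log (1/delta)).  A coin of bias 1/2 - q is a fair coin
   that is replaced by 0 with probability 2q.  So the number of successes dominates a fair binomial
   variable with a random number K of its n coins removed, where E K <= 0.154 S, and an affine lower
   bound, as a function of K, for the upper tail of the remaining coins is enough.  For
   log (1/delta) <= 25 the tangent at K = 0 works; beyond that, Markov's inequality for K reduces
   the claim to a lower bound for the tail of one fair binomial distribution. *)

theory Submission
  imports Defs
begin

section \<open>Upper tails of fair coins\<close>

primrec fair_tail :: "nat \<Rightarrow> nat \<Rightarrow> real" where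
  "fair_tail 0 c = of_bool (c = 0)"
| "fair_tail (Suc m) c = (fair_tail m (c - 1) + fair_tail m c) / 2"

lemma fair_tail_0 [simp]: "fair_tail m 0 = 1"
  by (induction m) auto

lemma fair_tail_eq_0: "m < c \<Longrightarrow> fair_tail m c = 0"
  by (induction m arbitrary: c) auto

lemma fair_tail_nonneg: "0 \<le> fair_tail m c"
  by (induction m arbitrary: c) (auto simp: add_nonneg_nonneg)

lemma fair_tail_diff: "fair_tail m c - fair_tail m (Suc c) = real (m choose c) / 2 ^ m"
proof (induction m arbitrary: c)
  case 0
  then show ?case by (cases c) auto
next
  case (Suc m)
  show ?case
  proof (cases c)
    case 0
    then show ?thesis using Suc.IH[of 0] by (simp add: field_simps)
  next
    case (Suc b)
    then show ?thesis using Suc.IH[of b] Suc.IH[of c] by (simp add: field_simps)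
  qed
qed

lemma fair_tail_Suc_diff:
  "fair_tail (Suc m) (Suc c) = fair_tail m (Suc c) + real (m choose c) / 2 ^ m / 2"
  using fair_tail_diff[of m c] by simp

lemma fair_tail_mono:
  assumes "m \<le> m'"
  shows "fair_tail m c \<le> fair_tail m' c"
proof (cases c)
  case (Suc b)
  have "incseq (\<lambda>m. fair_tail m c)"
    unfolding Suc by (rule incseq_SucI) (simp add: fair_tail_Suc_diff del: fair_tail.simps)
  then show ?thesis using assms by (simp add: incseq_def)
qed simp

lemma fair_tail_symmetric:
  assumes "c \<le> Suc m"
  shows "fair_tail m c + fair_tail m (Suc m - c) = 1"
  using assms
proof (induction m arbitrary: c)
  case 0
  then show ?case by (cases c) auto
next
  case (Suc m)
  show ?case
  proof (cases "c = 0 \<or> c = Suc (Suc m)")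
    case True
    then show ?thesis by (auto simp: fair_tail_eq_0 simp del: fair_tail.simps)
  next
    case False
    then obtain b where b: "c = Suc b" "b \<le> m" using Suc.prems by (cases c) auto
    then obtain k where "m = b + k" using le_Suc_ex by blast
    moreover have "(w + x) / 2 + (y + z) / 2 = 1" if "w + z = 1" "x + y = 1" for w x y z :: real
      using that by argo
    ultimately show ?thesis
      using Suc.IH[of b] Suc.IH[of "Suc b"] b by simp
  qed
qed

lemma fair_tail_half: "fair_tail (2 * c + 1) (Suc c) = 1 / 2"
  using fair_tail_symmetric[of "Suc c" "2 * c + 1"] by (simp del: fair_tail.simps)

lemma binomial_mass_le_central:
  assumes "m \<le> 2 * c"
  shows "real (m choose c) / 2 ^ m \<le> real ((2 * c) choose c) / 4 ^ c"
  using assms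
proof (induction rule: inc_induct)
  case base
  show ?case by (simp add: power_mult)
next
  case (step m)
  obtain b where b: "c = Suc b" using step.hyps by (cases c) auto
  have "m choose c \<le> m choose b"
    using step.hyps binomial_antimono[of b "Suc b" m] unfolding b
    by (cases "Suc b \<le> m") (auto simp: binomial_eq_0)
  then have "real (m choose c) / 2 ^ m \<le> real (Suc m choose c) / 2 ^ Suc m"
    by (simp add: b field_simps)
  then show ?case using step.IH by linarith
qed

lemma fair_tail_tangent:
  assumes "2 * c + 1 \<le> n"
  shows "fair_tail m (Suc c) \<ge> 1 / 2 - real ((2 * c) choose c) / 4 ^ c / 2 * real (n - m)"
proof -
  define w where "w = real ((2 * c) choose c) / 4 ^ c / 2"
  have "w \<ge> 0" by (simp add: w_def)
  have *: "fair_tail m (Suc c) \<ge> 1 / 2 - w * real (2 * c + 1 - m)" if "m \<le> 2 * c + 1" for m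
    using that
  proof (induction rule: inc_induct)
    case base
    then show ?case using fair_tail_half[of c] by simp
  next
    case (step m)
    have "fair_tail (Suc m) (Suc c) - w \<le> fair_tail m (Suc c)"
      using binomial_mass_le_central[of m c] step.hyps
      by (simp add: fair_tail_Suc_diff w_def del: fair_tail.simps)
    moreover have "real (2 * c + 1 - m) = real (2 * c + 1 - Suc m) + 1"
      using step.hyps by linarith
    ultimately show ?case using step.IH by (simp add: algebra_simps del: fair_tail.simps)
  qed
  show ?thesis
  proof (cases "m \<le> 2 * c + 1")
    case True
    have "w * real (2 * c + 1 - m) \<le> w * real (n - m)"
      using assms \<open>w \<ge> 0\<close> by (intro mult_left_mono) auto
    then show ?thesis using *[OF True] by (simp add: w_def)
  next
    case False
    have "1 / 2 \<le> fair_tail m (Suc c)"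
      using fair_tail_mono[of "2 * c + 1" m "Suc c"] False
      unfolding fair_tail_half by simp
    moreover have "0 \<le> w * real (n - m)" using \<open>w \<ge> 0\<close> by simp
    ultimately show ?thesis unfolding w_def[symmetric] by linarith
  qed
qed

lemma central_binomial_Suc:
  "real ((2 * Suc a) choose Suc a) / 4 ^ Suc a
     = real ((2 * a) choose a) / 4 ^ a * ((2 * a + 1) / (2 * a + 2))"
proof -
  have 1: "Suc a * (Suc (2 * a + 1) choose Suc a) = Suc (2 * a + 1) * (2 * a + 1 choose a)"
    by (rule Suc_times_binomial)
  have 2: "Suc a * (Suc (2 * a) choose Suc a) = Suc (2 * a) * (2 * a choose a)"
    by (rule Suc_times_binomial)
  have 3: "(Suc (2 * a) choose Suc a) = (2 * a + 1 choose a)"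
    using binomial_symmetric[of a "2 * a + 1"] by simp
  have "real ((2 * Suc a) choose Suc a) = 2 * real (2 * a + 1 choose a)"
  proof -
    have "real (Suc a) * real ((2 * Suc a) choose Suc a) = real (Suc a) * (2 * real (2 * a + 1 choose a))"
      using arg_cong[OF 1, of real] unfolding of_nat_mult by simp
    then show ?thesis by (subst (asm) mult_left_cancel) auto
  qed
  moreover have "real (Suc a) * real (2 * a + 1 choose a) = (2 * real a + 1) * real (2 * a choose a)"
    using arg_cong[OF 2, of real] unfolding 3 of_nat_mult by simp
  ultimately have "real (Suc a) * real ((2 * Suc a) choose Suc a) = 2 * ((2 * real a + 1) * real (2 * a choose a))"
    by simp
  then have "real ((2 * Suc a) choose Suc a) = 2 * ((2 * real a + 1) * real (2 * a choose a)) / real (Suc a)"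
    by (subst eq_divide_eq) (simp add: mult.commute)
  moreover have "2 * real a + 2 = 2 * real (Suc a)" by simp
  ultimately show ?thesis by (simp add: field_simps del: binomial_Suc_Suc of_nat_Suc)
qed

lemma central_binomial_upper: "real ((2 * a) choose a) / 4 ^ a \<le> 1 / sqrt (2 * a + 1)"
proof -
  have "(real ((2 * a) choose a) / 4 ^ a)\<^sup>2 * (2 * a + 1) \<le> 1"
  proof (induction a)
    case (Suc a)
    define w where "w = real ((2 * a) choose a) / 4 ^ a"
    have "(2 * real a + 1) * (2 * real a + 3) \<le> 1 * (2 * real a + 2)\<^sup>2"
      by (simp add: power2_eq_square algebra_simps)
    then have "(2 * real a + 1) * (2 * real a + 3) / (2 * real a + 2)\<^sup>2 \<le> 1"
      by (subst pos_divide_le_eq) auto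
    then have "w\<^sup>2 * (2 * a + 1) * ((2 * real a + 1) * (2 * real a + 3) / (2 * real a + 2)\<^sup>2) \<le> 1"
      using Suc[folded w_def] by (intro mult_le_one[of "w\<^sup>2 * (2 * a + 1)"]) auto
    moreover have "(w * (u / v))\<^sup>2 * z = w\<^sup>2 * u * (u * z / v\<^sup>2)" for u v z
      by (simp add: power2_eq_square)
    moreover have "real (2 * Suc a + 1) = 2 * real a + 3" "real (2 * a + 1) = 2 * real a + 1" by auto
    ultimately show ?case
      unfolding central_binomial_Suc w_def[symmetric] by (simp only:)
  qed simp
  then have "(real ((2 * a) choose a) / 4 ^ a)\<^sup>2 \<le> (1 / sqrt (2 * a + 1))\<^sup>2"
    unfolding power_divide[of 1] real_sqrt_pow2[OF of_nat_0_le_iff] by (subst pos_le_divide_eq) auto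
  then show ?thesis by (rule power2_le_imp_le) simp
qed

lemma central_binomial_lower:
  assumes "a \<ge> 1"
  shows "real ((2 * a) choose a) / 4 ^ a \<ge> 1 / (2 * sqrt a)"
proof -
  have "(real ((2 * a) choose a) / 4 ^ a)\<^sup>2 * (4 * a) \<ge> 1"
    using assms
  proof (induction rule: dec_induct)
    case base
    then show ?case by (simp add: power2_eq_square)
  next
    case (step a)
    define w where "w = real ((2 * a) choose a) / 4 ^ a"
    have "real a * (2 * real a + 2)\<^sup>2 \<le> (2 * real a + 1)\<^sup>2 * (real a + 1)"
      by (simp add: power2_eq_square algebra_simps)
    then have "(2 * real a + 1)\<^sup>2 * (real a + 1) / (2 * real a + 2)\<^sup>2 \<ge> real a"
      by (subst pos_le_divide_eq) auto
    then have "w\<^sup>2 * 4 * ((2 * real a + 1)\<^sup>2 * (real a + 1) / (2 * real a + 2)\<^sup>2) \<ge> w\<^sup>2 * 4 * real a"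
      by (intro mult_left_mono) auto
    moreover have "(w * (u / v))\<^sup>2 * (4 * z) = w\<^sup>2 * 4 * (u\<^sup>2 * z / v\<^sup>2)" for u v z
      by (simp add: power2_eq_square)
    moreover have "1 \<le> w\<^sup>2 * 4 * real a" using step.IH[folded w_def] by simp
    moreover have "real (4 * Suc a) = 4 * (real a + 1)" by simp
    ultimately show ?case
      unfolding central_binomial_Suc w_def[symmetric] by (simp only:)
  qed
  then have "(1 / (2 * sqrt a))\<^sup>2 \<le> (real ((2 * a) choose a) / 4 ^ a)\<^sup>2"
    using assms unfolding power_divide[of 1] power_mult_distrib real_sqrt_pow2[OF of_nat_0_le_iff]
    by (subst pos_divide_le_eq) auto
  then show ?thesis by (rule power2_le_imp_le) simp
qed

lemma binomial_off_central:
  assumes "3 * d \<le> a"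
  shows "real ((2 * a) choose a) * exp (- 2 * (real d)\<^sup>2 / a) \<le> real ((2 * a) choose (a + d))"
  using assms
proof (induction d)
  case (Suc d)
  define y where "y = (2 * real d + 1) / (a + d + 1)"
  have a: "a > 0" "3 * real d + 3 \<le> a" using Suc.prems by auto
  have y: "0 \<le> y" "y \<le> 1 / 2" "y \<le> (2 * real d + 1) / a"
    using a by (auto simp: y_def field_simps intro!: frac_le)
  have "exp (- 2 * ((2 * real d + 1) / a)) \<le> exp (- 2 * y)"
    using y(3) unfolding exp_le_cancel_iff by linarith
  also have "- 2 * y \<le> ln (1 - y)"
    using ln_one_minus_pos_lower_bound[OF y(1,2)] mult_left_mono[OF y(2,1)]
    by (simp add: power2_eq_square)
  then have "exp (- 2 * y) \<le> 1 - y"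
    using y by (simp add: ln_ge_iff)
  finally have e: "exp (- 2 * ((2 * real d + 1) / a)) \<le> 1 - y" .
  have "(2 * a - (a + d)) * (2 * a choose (a + d)) = Suc (a + d) * (2 * a choose Suc (a + d))"
    by (metis Suc_times_binomial_eq binomial_absorb_comp binomial_absorption mult.commute)
  then have "real (2 * a - (a + d)) * real (2 * a choose (a + d)) = real (Suc (a + d)) * real (2 * a choose Suc (a + d))"
    by (metis of_nat_mult)
  moreover have "real (2 * a - (a + d)) = real a - real d" using a by linarith
  ultimately have r: "real (2 * a choose (a + Suc d)) = real (2 * a choose (a + d)) * (1 - y)"
    by (simp add: y_def field_simps)
  have "- 2 * (real (Suc d))\<^sup>2 / a = - 2 * (real d)\<^sup>2 / a + - 2 * ((2 * real d + 1) / a)"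
    using a by (simp add: field_simps power2_eq_square)
  then have "real ((2 * a) choose a) * exp (- 2 * (real (Suc d))\<^sup>2 / a)
     = (real ((2 * a) choose a) * exp (- 2 * (real d)\<^sup>2 / a)) * exp (- 2 * ((2 * real d + 1) / a))"
    unfolding exp_add[symmetric] mult.assoc by simp
  also have "\<dots> \<le> real (2 * a choose (a + d)) * (1 - y)"
    using Suc e by (intro mult_mono) auto
  finally show ?case using r by simp
qed simp

lemma fair_tail_ge_mass:
  assumes "m \<le> 2 * c" "c + r \<le> Suc m"
  shows "real r * (real (m choose (c + r - 1)) / 2 ^ m) \<le> fair_tail m c"
proof -
  have "fair_tail m c = fair_tail m (c + r) + (\<Sum>i<r. real (m choose (c + i)) / 2 ^ m)"
  proof (induction r)
    case (Suc r)
    then show ?case using fair_tail_diff[of m "c + r"] by simp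
  qed simp
  moreover have "(\<Sum>i<r. real (m choose (c + r - 1)) / 2 ^ m) \<le> (\<Sum>i<r. real (m choose (c + i)) / 2 ^ m)"
    using assms by (intro sum_mono divide_right_mono of_nat_mono binomial_antimono) auto
  ultimately show ?thesis using fair_tail_nonneg[of m "c + r"] by simp
qed

lemma fair_tail_lower:
  assumes "3 * (e + r) \<le> a" "a \<ge> 1"
  shows "real r / (2 * sqrt a) * exp (- 2 * (real (e + r))\<^sup>2 / a) \<le> fair_tail (2 * a) (a + e + 1)"
proof (cases "r = 0")
  case False
  have "real r / (2 * sqrt a) * exp (- 2 * (real (e + r))\<^sup>2 / a)
      = real r * (1 / (2 * sqrt a) * exp (- 2 * (real (e + r))\<^sup>2 / a))" by simp
  also have "\<dots> \<le> real r * (real ((2 * a) choose a) / 4 ^ a * exp (- 2 * (real (e + r))\<^sup>2 / a))"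
    by (intro mult_left_mono mult_right_mono central_binomial_lower assms) auto
  also have "\<dots> = real r * ((real ((2 * a) choose a) * exp (- 2 * (real (e + r))\<^sup>2 / a)) / 4 ^ a)"
    by simp
  also have "\<dots> \<le> real r * (real ((2 * a) choose (a + (e + r))) / 4 ^ a)"
    by (intro mult_left_mono divide_right_mono binomial_off_central assms) auto
  also have "\<dots> \<le> fair_tail (2 * a) (a + e + 1)"
    using fair_tail_ge_mass[of "2 * a" "a + e + 1" r] assms False
    by (simp add: power_mult add.assoc)
  finally show ?thesis .
qed (simp add: fair_tail_nonneg)

section \<open>Upper tails of biased coins\<close>

text \<open>The probability of at least \<open>c\<close> heads among \<open>m\<close> fair coins and coins of biases \<open>p 1\<close>
  to \<open>p n\<close>. The truncated subtraction is harmless, since at least 0 heads is a sure event.\<close>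

primrec mixed_tail :: "(nat \<Rightarrow> real) \<Rightarrow> nat \<Rightarrow> nat \<Rightarrow> nat \<Rightarrow> real" where
  "mixed_tail p m 0 c = fair_tail m c"
| "mixed_tail p m (Suc n) c = p (Suc n) * mixed_tail p m n (c - 1) + (1 - p (Suc n)) * mixed_tail p m n c"

lemma mixed_tail_fair_Suc:
  "mixed_tail p (Suc m) n c = (mixed_tail p m n (c - 1) + mixed_tail p m n c) / 2"
proof (induction n arbitrary: c)
  case (Suc n)
  show ?case by (simp add: Suc field_simps)
qed simp

lemma mixed_tail_mono:
  assumes "\<And>i. i \<in> {1..n} \<Longrightarrow> 0 \<le> p i \<and> p i \<le> 1"
  shows "mixed_tail p m n c \<le> mixed_tail p (Suc m) n c"
proof -
  have anti: "mixed_tail p m n c \<le> mixed_tail p m n (c - 1)"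
    using assms
  proof (induction n arbitrary: c)
    case 0
    then show ?case using fair_tail_diff[of m "c - 1"] by (cases c) (simp_all, simp add: diff_eq_eq)
  next
    case (Suc n)
    have "p (Suc n) * mixed_tail p m n (c - 1) \<le> p (Suc n) * mixed_tail p m n (c - 1 - 1)"
       "(1 - p (Suc n)) * mixed_tail p m n c \<le> (1 - p (Suc n)) * mixed_tail p m n (c - 1)"
      by (intro mult_left_mono Suc.IH; use Suc.prems in auto)+
    then show ?case by simp
  qed
  then show ?thesis by (simp add: mixed_tail_fair_Suc)
qed

lemma mixed_tail_ge_affine:
  assumes fair: "\<And>m. m \<le> N \<Longrightarrow> \<beta> - \<alpha> * (real N - real m) \<le> fair_tail m c"
    and "m + n \<le> N" "0 \<le> \<alpha>"
    and p: "\<And>i. i \<in> {1..n} \<Longrightarrow> 0 \<le> p i \<and> p i \<le> 1 \<and> 1 / 2 - q i \<le> p i"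
    and q: "\<And>i. i \<in> {1..n} \<Longrightarrow> q i \<le> 1 / 2 \<and> 0 \<le> q i"
  shows "\<beta> - \<alpha> * (real N - real m - real n + 2 * (\<Sum>i=1..n. q i)) \<le> mixed_tail p m n c"
  using assms(2,4,5)
proof (induction n arbitrary: m)
  case 0
  then show ?case using fair[of m] by simp
next
  case (Suc n)
  let ?A = "mixed_tail p m n c" and ?B = "mixed_tail p (Suc m) n c" and ?q = "q (Suc n)"
  define Q where "Q = (\<Sum>i=1..n. q i)"
  have AB: "?A \<le> ?B" using Suc.prems by (intro mixed_tail_mono) auto
  have A: "\<beta> - \<alpha> * (real N - real m - real n + 2 * Q) \<le> ?A"
    using Suc.prems Suc.IH[of m] by (auto simp: Q_def)
  have B: "\<beta> - \<alpha> * (real N - real m - real n - 1 + 2 * Q) \<le> ?B"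
    using Suc.prems Suc.IH[of "Suc m"] by (auto simp: Q_def algebra_simps)
  have q: "0 \<le> ?q" "?q \<le> 1 / 2" "1 / 2 - ?q \<le> p (Suc n)" using Suc.prems by auto
  have "\<beta> - \<alpha> * (real N - real m - real (Suc n) + 2 * (Q + ?q))
     = 2 * ?q * (\<beta> - \<alpha> * (real N - real m - real n + 2 * Q))
       + (1 - 2 * ?q) * (\<beta> - \<alpha> * (real N - real m - real n - 1 + 2 * Q))"
    by (simp add: algebra_simps)
  also have "\<dots> \<le> 2 * ?q * ?A + (1 - 2 * ?q) * ?B"
    using q A B by (intro add_mono mult_left_mono) auto
  also have "\<dots> = ?A + 2 * (1 / 2 - ?q) * (?B - ?A)"
    by (simp add: algebra_simps)
  also have "\<dots> \<le> ?A + 2 * p (Suc n) * (?B - ?A)"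
    using q AB by (intro add_left_mono mult_right_mono) auto
  also have "\<dots> = mixed_tail p m (Suc n) c"
    by (simp add: mixed_tail_fair_Suc field_simps)
  finally show ?case by (simp add: Q_def)
qed

lemma mixed_tail_ge_exp:
  fixes p q :: "nat \<Rightarrow> real" and L :: real
  assumes c: "2 * c + 1 \<le> n" "n \<le> 2 * c + 2"
    and L: "ln 4 \<le> L" "L \<le> (sqrt 2 - 1)\<^sup>2 * n"
    and p: "\<And>i. i \<in> {1..n} \<Longrightarrow> 0 \<le> p i \<and> p i \<le> 1 \<and> 1 / 2 - q i \<le> p i"
    and q: "\<And>i. i \<in> {1..n} \<Longrightarrow> q i \<le> 1 / 2 \<and> 0 \<le> q i"
    and sum_q: "2 * (\<Sum>i=1..n. q i) \<le> (77 / 500) * sqrt (n * L)"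
  shows "exp (- L) \<le> mixed_tail p 0 n (Suc c)"
proof -
  define Q where "Q = 2 * (\<Sum>i=1..n. q i)"
  define u where "u = sqrt L"
  define v where "v = sqrt n"
  have "(4::real) = 2 * 2" by simp
  then have "ln (4::real) = ln 2 + ln 2" by (metis ln_mult_pos zero_less_numeral)
  then have "4 / 3 \<le> L" using ln2_ge_two_thirds L(1) by linarith
  then have uu: "u\<^sup>2 = L" and u: "0 < u" by (auto simp: u_def)
  have vv: "v\<^sup>2 = n" and v0: "0 \<le> v" by (auto simp: v_def)
  have Q: "Q \<le> (77 / 500) * (u * v)"
    using sum_q by (simp add: Q_def u_def v_def real_sqrt_mult mult.commute)
  have "sqrt 2 \<le> (14143 / 10000)"
    by (rule real_le_lsqrt) (auto simp: power2_eq_square)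
  then have s2: "0 \<le> sqrt 2 - 1" "sqrt 2 - 1 \<le> (4143 / 10000)" by auto
  have "u \<le> (sqrt 2 - 1) * v"
  proof (rule power2_le_imp_le)
    show "u\<^sup>2 \<le> ((sqrt 2 - 1) * v)\<^sup>2"
      using L(2) by (simp add: uu vv power_mult_distrib)
  qed (use s2(1) v0 in simp)
  also have "\<dots> \<le> (4143 / 10000) * v"
    using s2 v0 by (intro mult_right_mono) auto
  finally have uv: "u \<le> (4143 / 10000) * v" .
  then have v: "0 < v" using u by auto
  have affine: "\<beta> - \<alpha> * Q \<le> mixed_tail p 0 n (Suc c)"
    if "\<And>m. m \<le> n \<Longrightarrow> \<beta> - \<alpha> * (real n - real m) \<le> fair_tail m (Suc c)" "0 \<le> \<alpha>" for \<alpha> \<beta>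
    using mixed_tail_ge_affine[of n \<beta> \<alpha> "Suc c" 0 n p q] that p q by (simp add: Q_def)
  show ?thesis
  proof (cases "u \<le> 5")
    case True
    define w where "w = real ((2 * c) choose c) / 4 ^ c / 2"
    have w0: "0 \<le> w" by (simp add: w_def)
    have "L \<le> (17165 / 100000) * real n"
      using power_mono[OF uv, of 2] u unfolding power_mult_distrib uu vv by (simp add: power2_eq_square)
    then have "real n > 7" using \<open>4 / 3 \<le> L\<close> by linarith
    then have "n \<ge> 8" by simp
    then have "real n \<ge> 8" by simp
    moreover have "real n - 1 \<le> real (2 * c + 1)" using c by linarith
    ultimately have "7 / 8 * real n \<le> real (2 * c + 1)" by linarith
    then have "(v / (107 / 100))\<^sup>2 \<le> real (2 * c + 1)"
      unfolding power_divide vv by (simp add: power2_eq_square)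
    then have "v / (107 / 100) \<le> sqrt (2 * c + 1)"
      by (rule real_le_rsqrt)
    then have "1 / sqrt (2 * c + 1) \<le> 1 / (v / (107 / 100))"
      using v by (intro divide_left_mono) auto
    then have w: "w \<le> (107 / 200) / v"
      using central_binomial_upper[of c] unfolding w_def by simp
    have "1 / 2 - w * Q \<le> mixed_tail p 0 n (Suc c)"
    proof (rule affine)
      fix m assume "m \<le> n"
      then show "1 / 2 - w * (real n - real m) \<le> fair_tail m (Suc c)"
        using fair_tail_tangent[OF c(1), of m] unfolding w_def[symmetric] by (simp add: of_nat_diff)
    qed (rule w0)
    moreover have "w * Q \<le> (103 / 1250) * u"
    proof -
      have "w * Q \<le> w * ((77 / 500) * (u * v))" using w0 Q by (rule mult_left_mono[rotated])
      also have "\<dots> \<le> (107 / 200) / v * ((77 / 500) * (u * v))" using w u v by (intro mult_right_mono) auto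
      also have "\<dots> \<le> (103 / 1250) * u" using u v by simp
      finally show ?thesis .
    qed
    moreover have "exp (- L) \<le> 1 / 2 - (103 / 1250) * u"
    proof (cases "u \<le> 3")
      case True
      have "exp (- L) \<le> exp (- ln 4)" using L(1) by simp
      also have "\<dots> = 1 / 4" by (simp add: exp_minus)
      finally show ?thesis using True by simp
    next
      case False
      have "exp (- L) \<le> exp (- 9)"
        using False power_mono[of 3 u 2] by (simp add: uu)
      also have "\<dots> = 1 / (exp 3) ^ 3"
        by (simp add: exp_minus exp_of_nat_mult[symmetric] divide_simps)
      also have "\<dots> \<le> 1 / 4 ^ 3"
        using exp_ge_add_one_self[of 3] by (intro divide_left_mono power_mono) auto
      finally show ?thesis using \<open>u \<le> 5\<close> by simp
    qed
    ultimately show ?thesis by linarith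
  next
    case False
    define e where "e = nat \<lceil>(77 / 500) * (u * v)\<rceil>"
    define r where "r = nat \<lceil>v / 2\<rceil>"
    define a where "a = c - e"
    define \<gamma> where "\<gamma> = fair_tail (2 * a) (Suc c)"
    define k where "k = real n - 2 * real a"
    have "0 \<le> u * v" using u v by simp
    then have e: "(77 / 500) * (u * v) \<le> e" "e \<le> (77 / 500) * (u * v) + 1"
      unfolding e_def by linarith+
    have r: "v / 2 \<le> r" "r \<le> v / 2 + 1"
      using v unfolding r_def by linarith+
    have v12: "v \<ge> 12" using False uv by simp
    then have vs: "12 * v \<le> v\<^sup>2" by (simp add: power2_eq_square)
    have "u * v \<le> (4143 / 10000) * v * v" using uv v by (intro mult_right_mono) auto
    then have uv2: "u * v \<le> (4143 / 10000) * v\<^sup>2" by (simp add: power2_eq_square)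
    have c': "v\<^sup>2 / 2 - 1 \<le> c" using c by (simp add: vv)
    have "real e \<le> real c" using e(2) uv2 vs v12 c' by linarith
    then have a: "real a = real c - real e" unfolding a_def by simp
    have "e \<le> c" using \<open>real e \<le> real c\<close> by simp
    then have ce: "Suc c = a + e + 1" by (simp add: a_def)
    have a1: "(21 / 50) * v\<^sup>2 \<le> a" using a e(2) uv2 vs v12 c' by linarith
    have "a > 0" using a1 vs v12 by (cases a) auto
    have an: "a \<le> n" using c by (simp add: a_def)
    have er3: "3 * (real e + real r) \<le> real a"
    proof -
      have "real e \<le> 2 / 25 * v\<^sup>2" using e(2) uv2 vs v12 by linarith
      moreover have "real r \<le> 3 / 50 * v\<^sup>2" using r(2) vs v12 by linarith
      ultimately have "3 * (real e + real r) \<le> 21 / 50 * v\<^sup>2" by simp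
      then show ?thesis using a1 by (rule order_trans)
    qed
    then have "real (3 * (e + r)) \<le> real a" by simp
    then have "3 * (e + r) \<le> a" unfolding of_nat_le_iff .
    then have g: "real r / (2 * sqrt a) * exp (- 2 * (real (e + r))\<^sup>2 / a) \<le> \<gamma>"
      using fair_tail_lower[of e r a] \<open>a > 0\<close> ce by (simp add: \<gamma>_def)
    have "sqrt a \<le> v" using an by (simp add: v_def)
    then have "1 / 4 \<le> real r / (2 * sqrt a)"
      using r(1) \<open>a > 0\<close> by (simp add: field_simps)
    moreover have "exp (- (2 / 5) * L) \<le> exp (- 2 * (real (e + r))\<^sup>2 / a)"
    proof -
      have "5 * v \<le> u * v" using False v by (intro mult_right_mono) auto
      then have "real e + real r \<le> (36 / 125) * (u * v)" using e(2) r(2) v12 by linarith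
      then have "real (e + r) \<le> (36 / 125) * (u * v)" by simp
      then have "(real (e + r))\<^sup>2 \<le> ((36 / 125) * (u * v))\<^sup>2" by (intro power_mono) auto
      also have "\<dots> = (36 / 125)\<^sup>2 * (L * v\<^sup>2)"
        unfolding power_mult_distrib uu ..
      also have "\<dots> \<le> (1 / 5) * (21 / 50) * (L * v\<^sup>2)"
        using \<open>4 / 3 \<le> L\<close> by (intro mult_right_mono) (auto simp: power2_eq_square)
      also have "\<dots> = (1 / 5) * L * ((21 / 50) * v\<^sup>2)" by simp
      also have "\<dots> \<le> (1 / 5) * L * a"
        using a1 \<open>4 / 3 \<le> L\<close> by (intro mult_left_mono) auto
      finally show ?thesis using \<open>a > 0\<close> by (simp add: field_simps)
    qed
    ultimately have "1 / 4 * exp (- (2 / 5) * L) \<le> \<gamma>"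
      using g by (intro order_trans[OF mult_mono g]) auto
    have k: "2 * ((77 / 500) * (u * v)) \<le> k" "0 < k"
      using c a e(1) \<open>0 \<le> u * v\<close> unfolding k_def by linarith+
    have \<gamma>: "0 \<le> \<gamma>" by (simp add: \<gamma>_def fair_tail_nonneg)
    have "\<gamma> - \<gamma> / k * Q \<le> mixed_tail p 0 n (Suc c)"
    proof (rule affine)
      fix m assume "m \<le> n"
      show "\<gamma> - \<gamma> / k * (real n - real m) \<le> fair_tail m (Suc c)"
      proof (cases "2 * a \<le> m")
        case True
        have "0 \<le> \<gamma> / k * (real n - real m)" using \<gamma> k \<open>m \<le> n\<close> by simp
        moreover have "\<gamma> \<le> fair_tail m (Suc c)"
          unfolding \<gamma>_def using True by (rule fair_tail_mono)
        ultimately show ?thesis by linarith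
      next
        case False
        then have "\<gamma> / k * k \<le> \<gamma> / k * (real n - real m)"
          using \<gamma> k by (intro mult_left_mono) (auto simp: k_def)
        then show ?thesis using k fair_tail_nonneg[of m "Suc c"] by simp
      qed
    qed (use \<gamma> k in auto)
    moreover have "\<gamma> / k * Q \<le> \<gamma> / k * (k / 2)"
      using \<gamma> k Q by (intro mult_left_mono) auto
    ultimately have "\<gamma> / 2 \<le> mixed_tail p 0 n (Suc c)" using k by simp
    moreover have "exp (- L) \<le> 1 / 8 * exp (- (2 / 5) * L)"
    proof -
      have "25 \<le> L" using False power_mono[of 5 u 2] by (simp add: uu)
      then have "8 \<le> exp ((3 / 5) * L)" using exp_ge_add_one_self[of "(3 / 5) * L"] by linarith
      then have "8 * exp (- L) \<le> exp ((3 / 5) * L) * exp (- L)" by (intro mult_right_mono) auto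
      also have "\<dots> = exp (- (2 / 5) * L)" unfolding exp_add[symmetric] by simp
      finally show ?thesis by simp
    qed
    ultimately show ?thesis using \<open>1 / 4 * exp (- (2 / 5) * L) \<le> \<gamma>\<close> by linarith
  qed
qed

section \<open>Counting Gaussian exceedances\<close>

lemma card_ge_eq_sum_indicator:
  "real (card {i \<in> {1..n}. s \<le> x i}) = (\<Sum>i\<in>{1..n::nat}. indicator {s..} (x i :: real))"
  by (simp add: indicator_def sum.If_cases Int_def)

lemma (in prob_space) prob_count_eq_mixed_tail:
  fixes X :: "nat \<Rightarrow> 'a \<Rightarrow> real"
  assumes "indep_vars (\<lambda>_. borel) X {1..n}"
  shows "prob {\<omega> \<in> space M. c \<le> card {i \<in> {1..n}. s \<le> X i \<omega>}}
           = mixed_tail (\<lambda>i. prob {\<omega> \<in> space M. s \<le> X i \<omega>}) 0 n c"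
  using assms
proof (induction n arbitrary: c)
  case 0
  show ?case by (cases c) (auto simp: prob_space)
next
  case (Suc n)
  define p where "p = (\<lambda>i. prob {\<omega> \<in> space M. s \<le> X i \<omega>})"
  define Y where "Y = (\<lambda>i \<omega>. indicator {s..} (X i \<omega>) :: real)"
  define N where "N = (\<lambda>\<omega>. \<Sum>i\<in>{1..n}. Y i \<omega>)"
  have I: "{1..Suc n} = insert (Suc n) {1..n}" by auto
  have X [measurable]: "X i \<in> borel_measurable M" if "i \<in> {1..Suc n}" for i
    using Suc.prems that by (auto simp: indep_vars_def)
  have [measurable]: "X (Suc n) \<in> borel_measurable M" by (rule X) simp
  have NM [measurable]: "N \<in> borel_measurable M"
    unfolding N_def Y_def by (intro borel_measurable_sum) (use X in measurable)
  have "indep_vars (\<lambda>_. borel) Y {1..Suc n}"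
    unfolding Y_def by (rule indep_vars_compose2[OF Suc.prems]) auto
  then have indep: "indep_var borel (Y (Suc n)) borel N"
    unfolding I N_def by (intro indep_vars_sum) auto
  have N: "N \<omega> = real (card {i \<in> {1..n}. s \<le> X i \<omega>})" for \<omega>
    unfolding N_def Y_def card_ge_eq_sum_indicator ..
  have IH: "prob {\<omega> \<in> space M. real c \<le> N \<omega>} = mixed_tail p 0 n c" for c
    unfolding N p_def using Suc.IH[of c] indep_vars_subset[OF Suc.prems, of "{1..n}"] by (simp add: I)
  let ?A = "{\<omega> \<in> space M. s \<le> X (Suc n) \<omega> \<and> real (c - 1) \<le> N \<omega>}"
  let ?B = "{\<omega> \<in> space M. \<not> s \<le> X (Suc n) \<omega> \<and> real c \<le> N \<omega>}"
  have "{i \<in> {1..Suc n}. s \<le> X i \<omega>} =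
     (if s \<le> X (Suc n) \<omega> then insert (Suc n) {i \<in> {1..n}. s \<le> X i \<omega>} else {i \<in> {1..n}. s \<le> X i \<omega>})" for \<omega>
    unfolding I by auto
  then have "{\<omega> \<in> space M. c \<le> card {i \<in> {1..Suc n}. s \<le> X i \<omega>}} = ?A \<union> ?B"
    by (auto simp: N)
  moreover have "prob (?A \<union> ?B) = prob ?A + prob ?B"
    by (rule finite_measure_Union) auto
  moreover have "prob ?A = p (Suc n) * mixed_tail p 0 n (c - 1)"
  proof -
    have "?A = (\<lambda>\<omega>. (Y (Suc n) \<omega>, N \<omega>)) -` ({1} \<times> {real (c - 1)..}) \<inter> space M"
      by (auto simp: Y_def indicator_def)
    also have "prob \<dots> = prob (Y (Suc n) -` {1} \<inter> space M) * prob (N -` {real (c - 1)..} \<inter> space M)"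
      by (rule indep_varD[OF indep]) auto
    also have "Y (Suc n) -` {1} \<inter> space M = {\<omega> \<in> space M. s \<le> X (Suc n) \<omega>}"
      by (auto simp: Y_def indicator_def)
    also have "N -` {real (c - 1)..} \<inter> space M = {\<omega> \<in> space M. real (c - 1) \<le> N \<omega>}"
      by auto
    finally show ?thesis unfolding IH p_def .
  qed
  moreover have "prob ?B = (1 - p (Suc n)) * mixed_tail p 0 n c"
  proof -
    have "?B = (\<lambda>\<omega>. (Y (Suc n) \<omega>, N \<omega>)) -` ({0} \<times> {real c..}) \<inter> space M"
      by (auto simp: Y_def indicator_def)
    also have "prob \<dots> = prob (Y (Suc n) -` {0} \<inter> space M) * prob (N -` {real c..} \<inter> space M)"
      by (rule indep_varD[OF indep]) auto
    also have "Y (Suc n) -` {0} \<inter> space M = space M - {\<omega> \<in> space M. s \<le> X (Suc n) \<omega>}"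
      by (auto simp: Y_def indicator_def)
    also have "prob \<dots> = 1 - p (Suc n)"
      unfolding p_def by (rule prob_compl) measurable
    also have "N -` {real c..} \<inter> space M = {\<omega> \<in> space M. real c \<le> N \<omega>}"
      by auto
    finally show ?thesis unfolding IH .
  qed
  ultimately show ?case by (simp add: p_def)
qed

lemma borel_measurable_emp_median:
  assumes "n \<ge> 1" "\<And>i. i \<in> {1..n} \<Longrightarrow> X i \<in> borel_measurable M"
  shows "(\<lambda>\<omega>. emp_median n (\<lambda>i. X i \<omega>)) \<in> borel_measurable M"
  unfolding borel_measurable_iff_ge
proof
  fix s
  have "(\<lambda>\<omega>. \<Sum>i\<in>{1..n}. indicator {s..} (X i \<omega>) :: real) \<in> borel_measurable M"
    using assms(2) by (intro borel_measurable_sum) measurable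
  then show "{\<omega> \<in> space M. s \<le> emp_median n (\<lambda>i. X i \<omega>)} \<in> sets M"
    unfolding emp_median_ge_iff[OF assms(1)] card_ge_eq_sum_indicator by measurable
qed

lemma (in prob_space) prob_normal_ge_mean:
  assumes X: "distributed M lborel X (normal_density \<theta> \<sigma>)" and "\<sigma> > 0"
  shows "1 / 2 \<le> prob {\<omega> \<in> space M. \<theta> \<le> X \<omega>}"
proof -
  have [measurable]: "X \<in> borel_measurable M"
    using distributed_measurable[OF X] by simp
  have Y: "distributed M lborel (\<lambda>\<omega>. 2 * \<theta> + (-1) * X \<omega>) (normal_density \<theta> \<sigma>)"
    using normal_density_affine[OF X \<open>\<sigma> > 0\<close>, of "-1" "2 * \<theta>"] by simp
  have "distr M lborel X = distr M lborel (\<lambda>\<omega>. 2 * \<theta> + (-1) * X \<omega>)"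
    using distributed_distr_eq_density[OF X] distributed_distr_eq_density[OF Y] by simp
  then have "measure (distr M lborel X) {\<theta>..} = measure (distr M lborel (\<lambda>\<omega>. 2 * \<theta> + (-1) * X \<omega>)) {\<theta>..}"
    by simp
  then have "prob (X -` {\<theta>..} \<inter> space M) = prob ((\<lambda>\<omega>. 2 * \<theta> + (-1) * X \<omega>) -` {\<theta>..} \<inter> space M)"
    by (subst (asm) (1 2) measure_distr) auto
  moreover have "X -` {\<theta>..} \<inter> space M = {\<omega> \<in> space M. \<theta> \<le> X \<omega>}"
    "(\<lambda>\<omega>. 2 * \<theta> + (-1) * X \<omega>) -` {\<theta>..} \<inter> space M = {\<omega> \<in> space M. X \<omega> \<le> \<theta>}"
    by auto
  moreover have "1 \<le> prob {\<omega> \<in> space M. \<theta> \<le> X \<omega>} + prob {\<omega> \<in> space M. X \<omega> \<le> \<theta>}"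
  proof -
    have "{\<omega> \<in> space M. \<theta> \<le> X \<omega>} \<union> {\<omega> \<in> space M. X \<omega> \<le> \<theta>} = space M" by auto
    then have "1 = prob ({\<omega> \<in> space M. \<theta> \<le> X \<omega>} \<union> {\<omega> \<in> space M. X \<omega> \<le> \<theta>})"
      by (simp add: prob_space)
    also have "\<dots> \<le> prob {\<omega> \<in> space M. \<theta> \<le> X \<omega>} + prob {\<omega> \<in> space M. X \<omega> \<le> \<theta>}"
      by (rule measure_Un_le) auto
    finally show ?thesis .
  qed
  ultimately show ?thesis by simp
qed

lemma (in prob_space) prob_normal_ge:
  assumes X: "distributed M lborel X (normal_density \<theta> \<sigma>)" and "\<sigma> > 0" "t \<ge> 0"
  shows "1 / 2 - t / (sqrt (2 * pi) * \<sigma>) \<le> prob {\<omega> \<in> space M. \<theta> + t \<le> X \<omega>}"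
proof -
  define k where "k = 1 / (sqrt (2 * pi) * \<sigma>)"
  have k: "k \<ge> 0" using assms by (simp add: k_def)
  have [measurable]: "X \<in> borel_measurable M"
    using distributed_measurable[OF X] by simp
  have dens: "normal_density \<theta> \<sigma> x \<le> k" for x
    using \<open>\<sigma> > 0\<close> by (simp add: normal_density_def k_def real_sqrt_mult mult_left_le divide_right_mono)
  have "emeasure M (X -` {\<theta>..<\<theta> + t} \<inter> space M) = emeasure (density lborel (\<lambda>x. ennreal (normal_density \<theta> \<sigma> x))) {\<theta>..<\<theta> + t}"
    unfolding distributed_distr_eq_density[OF X, symmetric] by (subst emeasure_distr) auto
  also have "\<dots> = (\<integral>\<^sup>+x. ennreal (normal_density \<theta> \<sigma> x) * indicator {\<theta>..<\<theta> + t} x \<partial>lborel)"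
    by (subst emeasure_density) auto
  also have "\<dots> \<le> (\<integral>\<^sup>+x. ennreal k * indicator {\<theta>..<\<theta> + t} x \<partial>lborel)"
    by (intro nn_integral_mono mult_right_mono ennreal_leI dens) auto
  also have "\<dots> = ennreal (k * t)"
    using assms(3) k by (simp add: nn_integral_cmult_indicator ennreal_mult)
  finally have "prob (X -` {\<theta>..<\<theta> + t} \<inter> space M) \<le> k * t"
    using k assms(3) by (simp add: emeasure_eq_measure)
  moreover have "prob {\<omega> \<in> space M. \<theta> \<le> X \<omega>}
      \<le> prob (X -` {\<theta>..<\<theta> + t} \<inter> space M) + prob {\<omega> \<in> space M. \<theta> + t \<le> X \<omega>}"
  proof -
    have "{\<omega> \<in> space M. \<theta> \<le> X \<omega>} = (X -` {\<theta>..<\<theta> + t} \<inter> space M) \<union> {\<omega> \<in> space M. \<theta> + t \<le> X \<omega>}"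
      using assms(3) by auto
    then show ?thesis by (simp only:) (rule measure_Un_le; measurable)
  qed
  moreover have "t / (sqrt (2 * pi) * \<sigma>) = k * t" by (simp add: k_def)
  ultimately show ?thesis using prob_normal_ge_mean[OF X assms(2)] by linarith
qed

theorem theorem2:
  fixes M :: "'a measure" and X :: "nat \<Rightarrow> 'a \<Rightarrow> real"
    and n j :: nat and \<theta> \<delta> :: real and \<sigma> :: "nat \<Rightarrow> real"
  assumes "prob_space M"
    and "n \<ge> 1"
    and "\<And>i. i \<in> {1..n} \<Longrightarrow> 0 < \<sigma> i"
    and "mono_on {1..n} \<sigma>"
    and "exp (- (sqrt 2 - 1)\<^sup>2 * real n) < \<delta>" and "\<delta> < 1 / 4"
    and "prob_space.indep_vars M (\<lambda>_. borel) X {1..n}"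
    and "\<And>i. i \<in> {1..n} \<Longrightarrow> distributed M lborel (X i) (normal_density \<theta> (\<sigma> i))"
    and "j = nat \<lfloor>0.05 * sqrt (real n * ln (1 / \<delta>))\<rfloor>"
  shows "measure M {\<omega> \<in> space M.
           \<bar>emp_median n (\<lambda>i. X i \<omega>) - \<theta>\<bar>
             \<ge> 0.13 * (sqrt (real n * ln (1 / \<delta>)) / (\<Sum>i = j + 1..n. inverse (\<sigma> i)))}
         \<ge> \<delta>"
proof -
  interpret prob_space M by fact
  define L where "L = ln (1 / \<delta>)"
  define S where "S = sqrt (real n * L)"
  define D where "D = (\<Sum>i = j + 1..n. inverse (\<sigma> i))"
  define t where "t = 0.13 * (S / D)"
  define p where "p = (\<lambda>i. prob {\<omega> \<in> space M. \<theta> + t \<le> X i \<omega>})"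
  define q where "q = (\<lambda>i. if i \<le> j then 1 / 2 else min (1 / 2) (0.4 * t * inverse (\<sigma> i)))"
  define c where "c = (n - 1) div 2"
  have \<delta>: "0 < \<delta>" using assms(5) exp_gt_zero by (rule less_trans[rotated])
  then have expL: "exp (- L) = \<delta>" by (simp add: L_def ln_div)
  have "ln (4::real) \<le> ln (1 / \<delta>)"
    using \<delta> assms(6) by (subst ln_le_cancel_iff) (auto simp: field_simps)
  then have L4: "ln 4 \<le> L" by (simp add: L_def)
  then have "0 < L" using ln_gt_zero[of "4::real"] by linarith
  have "exp (- (sqrt 2 - 1)\<^sup>2 * real n) < exp (- L)" using assms(5) expL by simp
  then have Ln: "L \<le> (sqrt 2 - 1)\<^sup>2 * real n" by simp
  have "sqrt 2 \<le> 2" by (rule real_le_lsqrt) auto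
  moreover have "1 \<le> sqrt 2" by simp
  ultimately have "(sqrt 2 - 1)\<^sup>2 \<le> 1" by (intro power_le_one) auto
  then have "L \<le> real n" using Ln mult_right_mono[of "(sqrt 2 - 1)\<^sup>2" 1 "real n"] by simp
  then have "real n * L \<le> real n * real n" by (intro mult_left_mono) auto
  then have Sn: "S \<le> real n" unfolding S_def by (intro real_le_lsqrt) (auto simp: power2_eq_square)
  have "0 < S" using \<open>0 < L\<close> assms(2) by (simp add: S_def)
  then have j: "real j \<le> 0.05 * S" using of_nat_floor[of "0.05 * S"] unfolding assms(9) S_def L_def by simp
  then have "real j < real n" using Sn \<open>0 < S\<close> by simp
  then have "j < n" by simp
  have "0 < D"
    unfolding D_def using \<open>j < n\<close> assms(3) by (intro sum_pos) auto
  then have "0 < t" using \<open>0 < S\<close> by (simp add: t_def)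
  have X [measurable]: "X i \<in> borel_measurable M" if "i \<in> {1..n}" for i
    using distributed_measurable[OF assms(8)[OF that]] by simp
  have "2.5 \<le> sqrt (2 * pi)"
    using pi_approx(1) by (intro real_le_rsqrt) (simp add: power2_eq_square)
  have p: "0 \<le> p i \<and> p i \<le> 1 \<and> 1 / 2 - q i \<le> p i" if i: "i \<in> {1..n}" for i
  proof -
    have "1 / 2 - t / (sqrt (2 * pi) * \<sigma> i) \<le> p i"
      unfolding p_def using assms(3,8) i \<open>0 < t\<close> by (intro prob_normal_ge) auto
    moreover have "t / (sqrt (2 * pi) * \<sigma> i) \<le> t / (2.5 * \<sigma> i)"
      using \<open>2.5 \<le> sqrt (2 * pi)\<close> \<open>0 < t\<close> assms(3)[OF i]
      by (intro divide_left_mono mult_right_mono mult_pos_pos) auto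
    moreover have "t / (2.5 * \<sigma> i) = 0.4 * t * inverse (\<sigma> i)" by (simp add: field_simps)
    moreover have "0 \<le> p i" "p i \<le> 1" by (auto simp: p_def)
    ultimately show ?thesis by (auto simp: q_def min_def)
  qed
  have q: "q i \<le> 1 / 2 \<and> 0 \<le> q i" if "i \<in> {1..n}" for i
    using \<open>0 < t\<close> assms(3)[OF that] by (auto simp: q_def)
  have "(\<Sum>i=1..n. q i) = (\<Sum>i=1..j. q i) + (\<Sum>i=j+1..n. q i)"
    using \<open>j < n\<close> sum.ub_add_nat[of 1 j q "n - j"] by simp
  also have "(\<Sum>i=1..j. q i) = real j / 2" by (simp add: q_def)
  also have "(\<Sum>i=j+1..n. q i) \<le> (\<Sum>i=j+1..n. 0.4 * t * inverse (\<sigma> i))"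
    by (intro sum_mono) (auto simp: q_def)
  also have "\<dots> = 0.4 * t * D" by (simp add: D_def sum_distrib_left)
  also have "\<dots> = 0.052 * S" using \<open>0 < D\<close> by (simp add: t_def)
  finally have "2 * (\<Sum>i=1..n. q i) \<le> 77 / 500 * S" using j by simp
  then have "\<delta> \<le> mixed_tail p 0 n (Suc c)"
    unfolding S_def expL[symmetric] using assms(2) L4 Ln p q
    by (intro mixed_tail_ge_exp[where q = q]) (auto simp: c_def)
  also have "\<dots> = prob {\<omega> \<in> space M. Suc c \<le> card {i \<in> {1..n}. \<theta> + t \<le> X i \<omega>}}"
    unfolding p_def by (rule prob_count_eq_mixed_tail[symmetric]) fact
  also have "\<dots> = prob {\<omega> \<in> space M. \<theta> + t \<le> emp_median n (\<lambda>i. X i \<omega>)}"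
  proof -
    have "Suc c \<le> k \<longleftrightarrow> real n / 2 \<le> real k" for k
      using assms(2) unfolding c_def by linarith
    then show ?thesis by (simp add: emp_median_ge_iff[OF assms(2)])
  qed
  also have "\<dots> \<le> prob {\<omega> \<in> space M. t \<le> \<bar>emp_median n (\<lambda>i. X i \<omega>) - \<theta>\<bar>}"
  proof (rule finite_measure_mono)
    have [measurable]: "(\<lambda>\<omega>. emp_median n (\<lambda>i. X i \<omega>)) \<in> borel_measurable M"
      using assms(2) X by (rule borel_measurable_emp_median)
    show "{\<omega> \<in> space M. t \<le> \<bar>emp_median n (\<lambda>i. X i \<omega>) - \<theta>\<bar>} \<in> sets M" by measurable
  qed auto
  finally show ?thesis by (simp only: t_def S_def L_def D_def)
qed

end
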